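(* Let $\Theta_1,\Theta_2:\mathbb{R}_{+*}^{n_1 n_2}\to[0,\infty)$ be two continuous functions such that, for each $k\in\{1,2\}$, $$\forall \gamma\in\mathbb{R}_{+*}^{n_1 n_2},\qquad F\big(P_{\mathcal{C}_k}^{\Theta_k(\gamma)}(\gamma)\big)\le F(\gamma),$$ where the inequality is strict whenever $\gamma\notin\mathcal{C}_k$. Consider the sequence $(\gamma^\ell)_{\ell\ge 0}$ defined by $\gamma^0=e^{-c/\varepsilon}$ (entrywise exponential) and, for $\ell\ge 0$, $$\tilde\gamma^{\ell+1}=P_{\mathcal{C}_1}^{\Theta_1(\gamma^\ell)}(\gamma^\ell),\qquad \gamma^{\ell+1}=P_{\mathcal{C}_2}^{\Theta_2(\tilde\gamma^{\ell+1})}(\tilde\gamma^{\ell+1}).$$ Then the sequence $(\gamma^\ell)$ converges to $\gamma^*$.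
   Context: Let $\mathbb{R}_+=[0,\infty)$ and $\mathbb{R}_{+*}=(0,\infty)$. Let $n_1,n_2\ge 1$ be integers, let $\mu_1\in\mathbb{R}_{+*}^{n_1}$ and $\mu_2\in\mathbb{R}_{+*}^{n_2}$ be discrete probability measures (positive entries summing to $1$), let $c\in\mathbb{R}_+^{n_1\times n_2}$ be a cost matrix, and let $\varepsilon>0$. Elements of $\mathbb{R}^{n_1n_2}$ are viewed as $n_1\times n_2$ matrices. Define the linear maps $(A_1x)_i=\sum_j x_{i,j}$ (row sums, with values in $\mathbb{R}^{n_1}$) and $(A_2x)_j=\sum_i x_{i,j}$ (column sums, with values in $\mathbb{R}^{n_2}$), and $\mathcal{C}_k=\{\gamma\in\mathbb{R}^{n_1n_2}: A_k\gamma=\mu_k\}$ for $k=1,2$. Kullback–Leibler divergence: $\mathrm{KL}(\gamma,\zeta)=\sum_{i,j}\gamma_{i,j}\big(\log(\gamma_{i,j}/\zeta_{i,j})-1\big)+\sum_{i,j}\zeta_{i,j}$, with $0\log 0=0$. The matrix $\gamma^*$ is the unique minimizer of $\gamma\mapsto\sum_{i,j}c_{i,j}\gamma_{i,j}+\varepsilon\,\mathrm{KL}(\gamma,\mathbf{1})$ over $\mathcal{C}_1\cap\mathcal{C}_2\cap\mathbb{R}_+^{n_1n_2}$, where $\mathbf{1}$ is the all-ones matrix; equivalently, $\gamma^*$ is the minimizer of $\mathrm{KL}(\cdot,e^{-c/\varepsilon})$ over $\mathcal{C}_1\cap\mathcal{C}_2$ (among nonnegative matrices). Lyapunov function: $F(\gamma)=\mathrm{KL}(\gamma^*,\gamma)$.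 Bregman projections of $\gamma\in\mathbb{R}_{+*}^{n_1n_2}$: $P_{\mathcal{C}_1}(\gamma)_{i,j}=\frac{(\mu_1)_i}{(A_1\gamma)_i}\gamma_{i,j}$ and $P_{\mathcal{C}_2}(\gamma)_{i,j}=\gamma_{i,j}\frac{(\mu_2)_j}{(A_2\gamma)_j}$. For $\omega\ge 0$, the $\omega$-relaxed projection $P^\omega_{\mathcal{C}_k}$ is defined by $\log P^\omega_{\mathcal{C}_k}(\gamma)=(1-\omega)\log\gamma+\omega\log P_{\mathcal{C}_k}(\gamma)$, with the logarithm taken entrywise. *)

theory Defs
  imports "HOL-Analysis.Analysis"
begin

(* An n1 x n2 matrix is a term of type real ^ 'n2 ^ 'n1, with entries x $ i $ j for i :: 'n1 and
   j :: 'n2. *)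

definition row_sums :: "real ^ 'n2 ^ 'n1 \<Rightarrow> real ^ 'n1" where
  "row_sums x = (\<chi> i. \<Sum>j\<in>UNIV. x $ i $ j)"

definition col_sums :: "real ^ 'n2 ^ 'n1 \<Rightarrow> real ^ 'n2" where
  "col_sums x = (\<chi> j. \<Sum>i\<in>UNIV. x $ i $ j)"

definition row_constraint :: "real ^ 'n1 \<Rightarrow> (real ^ 'n2 ^ 'n1) set" where
  "row_constraint \<mu> = {x. row_sums x = \<mu>}"

definition col_constraint :: "real ^ 'n2 \<Rightarrow> (real ^ 'n2 ^ 'n1) set" where
  "col_constraint \<mu> = {x. col_sums x = \<mu>}"

definition pos_matrices :: "(real ^ 'n2 ^ 'n1) set" where
  "pos_matrices = {x. \<forall>i j. 0 < x $ i $ j}"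

definition nonneg_matrices :: "(real ^ 'n2 ^ 'n1) set" where
  "nonneg_matrices = {x. \<forall>i j. 0 \<le> x $ i $ j}"

(* Meant for entrywise nonnegative x and entrywise positive z. The convention 0 log 0 = 0 holds
   because the logarithm is multiplied by x $ i $ j. *)
definition KL :: "real ^ 'n2 ^ 'n1 \<Rightarrow> real ^ 'n2 ^ 'n1 \<Rightarrow> real" where
  "KL x z = (\<Sum>i\<in>UNIV. \<Sum>j\<in>UNIV. x $ i $ j * (ln (x $ i $ j / z $ i $ j) - 1))
          + (\<Sum>i\<in>UNIV. \<Sum>j\<in>UNIV. z $ i $ j)"

definition ot_objective :: "real ^ 'n2 ^ 'n1 \<Rightarrow> real \<Rightarrow> real ^ 'n2 ^ 'n1 \<Rightarrow> real" where
  "ot_objective c \<epsilon> x =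
     (\<Sum>i\<in>UNIV. \<Sum>j\<in>UNIV. c $ i $ j * x $ i $ j) + \<epsilon> * KL x (\<chi> i j. 1)"

(* For probability vectors and \<epsilon> > 0 the feasible set is nonempty and compact and the objective is
   continuous and strictly convex on it, so the description below is proper. *)
definition ot_minimizer ::
  "real ^ 'n1 \<Rightarrow> real ^ 'n2 \<Rightarrow> real ^ 'n2 ^ 'n1 \<Rightarrow> real \<Rightarrow> real ^ 'n2 ^ 'n1" where
  "ot_minimizer \<mu>1 \<mu>2 c \<epsilon> =
     (THE x. is_arg_min (ot_objective c \<epsilon>)
        (\<lambda>y. y \<in> row_constraint \<mu>1 \<inter> col_constraint \<mu>2 \<inter> nonneg_matrices) x)"

definition lyapunov ::
  "real ^ 'n1 \<Rightarrow> real ^ 'n2 \<Rightarrow> real ^ 'n2 ^ 'n1 \<Rightarrow> real \<Rightarrow> real ^ 'n2 ^ 'n1 \<Rightarrow> real" where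
  "lyapunov \<mu>1 \<mu>2 c \<epsilon> x = KL (ot_minimizer \<mu>1 \<mu>2 c \<epsilon>) x"

definition row_proj :: "real ^ 'n1 \<Rightarrow> real ^ 'n2 ^ 'n1 \<Rightarrow> real ^ 'n2 ^ 'n1" where
  "row_proj \<mu> x = (\<chi> i j. \<mu> $ i / row_sums x $ i * x $ i $ j)"

definition col_proj :: "real ^ 'n2 \<Rightarrow> real ^ 'n2 ^ 'n1 \<Rightarrow> real ^ 'n2 ^ 'n1" where
  "col_proj \<mu> x = (\<chi> i j. x $ i $ j * (\<mu> $ j / col_sums x $ j))"

(* The positive matrix whose entrywise logarithm is (1 - \<omega>) log x + \<omega> log (P x); meant for x and
   P x entrywise positive. *)
definition relaxed_proj ::
  "(real ^ 'n2 ^ 'n1 \<Rightarrow> real ^ 'n2 ^ 'n1) \<Rightarrow> real \<Rightarrow> real ^ 'n2 ^ 'n1 \<Rightarrow> real ^ 'n2 ^ 'n1" where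
  "relaxed_proj P \<omega> x = (\<chi> i j. exp ((1 - \<omega>) * ln (x $ i $ j) + \<omega> * ln (P x $ i $ j)))"

end

theory Submission
  imports Defs
begin

text \<open>
  Write K for the entrywise exponential of -c/\<epsilon>. The relaxed projections only rescale rows and
  columns, so all iterates lie in the set of positive matrices of the form u_i K_ij v_j, which is
  closed in the positive matrices. By Gibbs' inequality the only feasible matrix of this form is
  the minimizer. Such a matrix exists: minimize KL(\<mu>1 \<mu>2^T, x) over the x of this form, and note that
  the row and column projections would decrease this divergence strictly if the minimizer were
  not feasible. In particular the optimal plan is positive, hence the sublevel sets of the Lyapunov
  function F lie in boxes bounded away from 0. A cluster point of the iterates cannot have its
  value of F decreased by one step, so it satisfies both constraints, and it is the optimal plan.
\<close>

section \<open>Gibbs' inequality\<close>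

text \<open>The scalar Bregman divergence generated by t log t - t; \<open>KL\<close> is its sum
  over all entries.\<close>

definition kl_term :: "real \<Rightarrow> real \<Rightarrow> real" where
  "kl_term p x = p * (ln (p / x) - 1) + x"

lemma KL_eq_sum_kl_term: "KL p x = (\<Sum>i\<in>UNIV. \<Sum>j\<in>UNIV. kl_term (p $ i $ j) (x $ i $ j))"
  by (simp add: KL_def kl_term_def sum.distrib)

lemma kl_term_self [simp]: "kl_term x x = 0"
  by (cases "x = 0") (auto simp: kl_term_def)

text \<open>This is ln t < t - 1 at t = x / p \<noteq> 1, multiplied by p. For p = 0 only the
  summand x is left.\<close>

lemma kl_term_pos:
  assumes "0 \<le> p" "0 < x" "p \<noteq> x"
  shows "0 < kl_term p x"
proof (cases "p = 0")
  case True
  then show ?thesis using assms by (simp add: kl_term_def)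
next
  case False
  then have p: "0 < p" using assms by simp
  have "ln (x / p) < x / p - 1"
  proof -
    have "ln (x / p) \<noteq> x / p - 1"
      using ln_eq_minus_one[of "x / p"] p assms by auto
    moreover have "ln (x / p) \<le> x / p - 1"
      using p assms by (intro ln_le_minus_one) simp
    ultimately show ?thesis by simp
  qed
  then have "p * ln (x / p) < p * (x / p - 1)"
    using p by (intro mult_strict_left_mono)
  then show ?thesis
    using p assms by (simp add: kl_term_def ln_div algebra_simps)
qed

lemma kl_term_nonneg: "0 \<le> p \<Longrightarrow> 0 < x \<Longrightarrow> 0 \<le> kl_term p x"
  by (cases "p = x") (auto intro: less_imp_le kl_term_pos)

text \<open>Dropping the positive summand x leaves p ln (p / x) \<le> B + p, which keeps x away from
  0.\<close>

lemma kl_term_le_imp_lower: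
  assumes "0 < p" "0 < x" "kl_term p x \<le> B"
  shows "p * exp (- (B / p + 1)) \<le> x"
proof -
  have "p * ln (p / x) \<le> B + p"
    using assms by (simp add: kl_term_def algebra_simps)
  then have "ln (p / x) \<le> B / p + 1"
    using assms by (simp add: field_simps)
  then have "p / x \<le> exp (B / p + 1)"
    using assms ln_ge_iff exp_ln[of "p / x"] exp_le_cancel_iff[of "ln (p / x)"] by simp
  then show ?thesis
    using assms by (simp add: exp_minus field_simps)
qed

lemma kl_term_le_imp_upper:
  assumes "0 < p" "0 < x" "kl_term p x \<le> B"
  shows "x \<le> 2 * B + 2 * p"
proof -
  \<comment> \<open>Applying the tangent bound at x / (2 p) instead of x / p makes the logarithm
    absorb only half of x; the other half gets bounded.\<close>
  have "ln (x / (2 * p)) \<le> x / (2 * p) - 1"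
    using assms by (intro ln_le_minus_one) simp
  moreover have "ln (2::real) \<le> 1"
    using ln_le_minus_one[of 2] by simp
  ultimately have "ln (x / p) \<le> x / (2 * p)"
    using assms by (simp add: ln_div ln_mult)
  then have "p * ln (x / p) \<le> x / 2"
    using assms by (simp add: field_simps)
  then show ?thesis
    using assms by (simp add: kl_term_def ln_div algebra_simps)
qed

lemma kl_term_le_KL:
  assumes "p \<in> nonneg_matrices" "x \<in> pos_matrices"
  shows "kl_term (p $ i $ j) (x $ i $ j) \<le> KL p x"
proof -
  have nn: "0 \<le> kl_term (p $ k $ l) (x $ k $ l)" for k l
    using assms by (simp add: kl_term_nonneg nonneg_matrices_def pos_matrices_def)
  have "kl_term (p $ i $ j) (x $ i $ j) \<le> (\<Sum>l\<in>UNIV. kl_term (p $ i $ l) (x $ i $ l))"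
    by (rule member_le_sum) (auto simp: nn)
  also have "\<dots> \<le> (\<Sum>k\<in>UNIV. \<Sum>l\<in>UNIV. kl_term (p $ k $ l) (x $ k $ l))"
    by (rule member_le_sum[where f = "\<lambda>k. \<Sum>l\<in>UNIV. kl_term (p $ k $ l) (x $ k $ l)"])
      (auto simp: nn intro: sum_nonneg)
  finally show ?thesis by (simp add: KL_eq_sum_kl_term)
qed

lemma KL_pos:
  assumes "p \<in> nonneg_matrices" "x \<in> pos_matrices" "p \<noteq> x"
  shows "0 < KL p x"
proof -
  obtain i j where "p $ i $ j \<noteq> x $ i $ j"
    using assms(3) by (auto simp: vec_eq_iff)
  then have "0 < kl_term (p $ i $ j) (x $ i $ j)"
    using assms by (intro kl_term_pos) (auto simp: nonneg_matrices_def pos_matrices_def)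
  then show ?thesis
    using kl_term_le_KL[OF assms(1,2), of i j] by simp
qed

lemma KL_self [simp]: "KL x x = 0"
  by (simp add: KL_eq_sum_kl_term)

text \<open>Serves to derive column statements from row statements.\<close>

lemma KL_transpose: "KL (transpose p) (transpose x) = KL p x"
  unfolding KL_eq_sum_kl_term by (subst sum.swap) (simp add: transpose_def)

lemma pos_matrices_subset_nonneg: "pos_matrices \<subseteq> nonneg_matrices"
  by (auto simp: pos_matrices_def nonneg_matrices_def less_imp_le)

lemma continuous_on_KL:
  assumes "p \<in> pos_matrices"
  shows "continuous_on pos_matrices (KL p)"
proof -
  have "continuous_on pos_matrices (\<lambda>x. KL p x)"
    unfolding KL_def
    using assms by (intro continuous_intros) (auto simp: pos_matrices_def less_imp_neq[symmetric])
  then show ?thesis by simp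
qed

section \<open>Compactness of sublevel sets\<close>

lemma compact_matrix_box:
  fixes lo hi :: "'n1::finite \<Rightarrow> 'n2::finite \<Rightarrow> real"
  shows "compact {x :: real ^ 'n2 ^ 'n1. \<forall>i j. lo i j \<le> x $ i $ j \<and> x $ i $ j \<le> hi i j}"
proof -
  have "{x :: real ^ 'n2 ^ 'n1. \<forall>i j. lo i j \<le> x $ i $ j \<and> x $ i $ j \<le> hi i j} =
    cbox (\<chi> i j. lo i j) (\<chi> i j. hi i j)"
    by (auto simp: mem_box Basis_vec_def inner_axis)
  then show ?thesis by simp
qed

text \<open>Collects the two entrywise bounds above: for positive p, every positive x with
  \<open>KL p x \<le> B\<close> lies in this box, which is compact and stays inside the positive
  matrices.\<close>

definition KL_box :: "real ^ 'n2 ^ 'n1 \<Rightarrow> real \<Rightarrow> (real ^ 'n2 ^ 'n1) set" where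
  "KL_box p B = {x. \<forall>i j. p $ i $ j * exp (- (B / p $ i $ j + 1)) \<le> x $ i $ j \<and>
                         x $ i $ j \<le> 2 * B + 2 * p $ i $ j}"

lemma compact_KL_box: "compact (KL_box p B)"
  unfolding KL_box_def by (rule compact_matrix_box)

lemma KL_box_subset_pos:
  assumes "p \<in> pos_matrices"
  shows "KL_box p B \<subseteq> pos_matrices"
proof
  fix x assume x: "x \<in> KL_box p B"
  have "0 < x $ i $ j" for i j
  proof -
    have "0 < p $ i $ j * exp (- (B / p $ i $ j + 1))"
      using assms by (simp add: pos_matrices_def)
    also have "\<dots> \<le> x $ i $ j"
      using x by (simp add: KL_box_def)
    finally show ?thesis .
  qed
  then show "x \<in> pos_matrices" by (simp add: pos_matrices_def)
qed

lemma KL_le_imp_in_box: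
  assumes "p \<in> pos_matrices" "x \<in> pos_matrices" "KL p x \<le> B"
  shows "x \<in> KL_box p B"
proof -
  have "kl_term (p $ i $ j) (x $ i $ j) \<le> B" for i j
    using kl_term_le_KL[of p x i j] assms pos_matrices_subset_nonneg by fastforce
  moreover have "0 < p $ i $ j" "0 < x $ i $ j" for i j
    using assms by (simp_all add: pos_matrices_def)
  ultimately show ?thesis
    unfolding KL_box_def by (blast intro: kl_term_le_imp_lower kl_term_le_imp_upper)
qed

section \<open>Diagonal scalings of a positive matrix\<close>

text \<open>The positive matrices of the form u_i K_ij v_j, encoded by cross ratios so that closedness is
  immediate.\<close>

definition scalings :: "real ^ 'n2 ^ 'n1 \<Rightarrow> (real ^ 'n2 ^ 'n1) set" where
  "scalings K = {x \<in> pos_matrices. \<forall>i j k l.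
     x $ i $ j * x $ k $ l * (K $ i $ l * K $ k $ j) =
     x $ i $ l * x $ k $ j * (K $ i $ j * K $ k $ l)}"

lemma scalings_subset_pos: "scalings K \<subseteq> pos_matrices"
  by (auto simp: scalings_def)

lemma self_in_scalings: "K \<in> pos_matrices \<Longrightarrow> K \<in> scalings K"
  by (simp add: scalings_def algebra_simps)

text \<open>Both sides of the cross-ratio identity acquire the same factor u_i u_k.\<close>

lemma scalings_scale_rows:
  assumes "x \<in> scalings K" "\<And>i. 0 < u i"
  shows "(\<chi> i j. x $ i $ j * u i) \<in> scalings K"
proof -
  have "x $ i $ j * u i * (x $ k $ l * u k) * (K $ i $ l * K $ k $ j) =
    x $ i $ l * u i * (x $ k $ j * u k) * (K $ i $ j * K $ k $ l)" for i j k l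
  proof -
    have "x $ i $ j * x $ k $ l * (K $ i $ l * K $ k $ j) =
      x $ i $ l * x $ k $ j * (K $ i $ j * K $ k $ l)"
      using assms by (simp add: scalings_def)
    then show ?thesis by algebra
  qed
  then show ?thesis
    using assms by (simp add: scalings_def pos_matrices_def)
qed

lemma transpose_in_pos_iff [simp]: "transpose x \<in> pos_matrices \<longleftrightarrow> x \<in> pos_matrices"
  by (auto simp: pos_matrices_def transpose_def)

lemma transpose_in_scalings_iff:
  "transpose x \<in> scalings (transpose K) \<longleftrightarrow> x \<in> scalings K"
proof -
  have "(\<forall>i j k l. x $ j $ i * x $ l $ k * (K $ l $ i * K $ j $ k) =
      x $ l $ i * x $ j $ k * (K $ j $ i * K $ l $ k)) \<longleftrightarrow>
    (\<forall>i j k l. x $ i $ j * x $ k $ l * (K $ i $ l * K $ k $ j) =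
      x $ i $ l * x $ k $ j * (K $ i $ j * K $ k $ l))"
    (is "(\<forall>i j k l. ?L i j k l) \<longleftrightarrow> (\<forall>i j k l. ?R i j k l)")
  proof -
    \<comment> \<open>Transposing swaps i with j and k with l; the rest is commutativity.\<close>
    have "?L i j k l \<longleftrightarrow> ?R j i l k" for i j k l
      by (simp only: mult.commute)
    then show ?thesis by blast
  qed
  then show ?thesis
    unfolding scalings_def mem_Collect_eq transpose_in_pos_iff
    by (simp add: transpose_def)
qed

lemma closed_cross_ratio:
  "closed {x :: real ^ 'n2 ^ 'n1. \<forall>i j k l.
     x $ i $ j * x $ k $ l * (K $ i $ l * K $ k $ j) =
     x $ i $ l * x $ k $ j * (K $ i $ j * K $ k $ l)}"
  by (intro closed_Collect_all closed_Collect_eq continuous_intros)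

text \<open>The box already forces positivity, so intersecting with \<open>scalings K\<close> adds
  only the closed cross-ratio condition.\<close>

lemma compact_KL_box_Int_scalings:
  assumes "p \<in> pos_matrices"
  shows "compact (KL_box p B \<inter> scalings K)"
proof -
  have "KL_box p B \<inter> scalings K = KL_box p B \<inter> {x. \<forall>i j k l.
     x $ i $ j * x $ k $ l * (K $ i $ l * K $ k $ j) =
     x $ i $ l * x $ k $ j * (K $ i $ j * K $ k $ l)}"
    using KL_box_subset_pos[OF assms, of B] by (auto simp: scalings_def)
  then show ?thesis
    by (simp only: compact_Int_closed[OF compact_KL_box closed_cross_ratio])
qed

text \<open>Recovers the factors u, v as logarithmic potentials. The logarithm of the cross-ratio
  identity says that ln x - ln K has vanishing mixed differences, so it splits into a row part and a
  column part.\<close>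

lemma scalings_ln_eq:
  fixes K :: "real ^ 'n2 ^ 'n1"
  assumes "x \<in> scalings K" "K \<in> pos_matrices"
  obtains f :: "'n1 \<Rightarrow> real" and g :: "'n2 \<Rightarrow> real"
  where "\<And>i j. ln (x $ i $ j) = ln (K $ i $ j) + f i + g j"
proof -
  define d where "d i j = ln (x $ i $ j) - ln (K $ i $ j)" for i j
  have "d i j + d k l = d i l + d k j" for i j k l
  proof -
    have pos: "0 < x $ a $ b" "0 < K $ a $ b" for a b
      using assms by (auto simp: scalings_def pos_matrices_def)
    have nz: "x $ a $ b \<noteq> 0" "K $ a $ b \<noteq> 0" for a b
      using pos[of a b] by auto
    have "ln (x $ i $ j * x $ k $ l * (K $ i $ l * K $ k $ j)) =
      ln (x $ i $ l * x $ k $ j * (K $ i $ j * K $ k $ l))"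
      using assms by (simp add: scalings_def)
    then show ?thesis
      by (simp add: ln_mult pos nz d_def)
  qed
  note cross = this
  show ?thesis
  \<comment> \<open>Here \<open>undefined\<close> is just an arbitrary base row and base column. The
    value at the base point is subtracted once, since both parts contain it.\<close>
  proof (rule that[of "\<lambda>i. d i undefined" "\<lambda>j. d undefined j - d undefined undefined"])
    fix i j
    show "ln (x $ i $ j) = ln (K $ i $ j) + d i undefined + (d undefined j - d undefined undefined)"
      using cross[of i j undefined undefined] by (simp add: d_def)
  qed
qed

section \<open>The optimal plan\<close>

text \<open>The potentials of x0 are paired with x linearly and see only its marginals, which are
  fixed on the feasible set. So up to a constant the objective there is the divergence from
  x0.\<close>

lemma ot_objective_eq_KL:
  fixes x0 :: "real ^ 'n2 ^ 'n1"
  assumes x0: "x0 \<in> scalings (\<chi> i j. exp (- c $ i $ j / \<epsilon>))" and "0 < \<epsilon>"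
  obtains \<kappa> where "\<And>x. x \<in> row_constraint \<mu>1 \<inter> col_constraint \<mu>2 \<inter> nonneg_matrices \<Longrightarrow>
    ot_objective c \<epsilon> x = \<epsilon> * KL x x0 + \<kappa>"
proof -
  have pos: "0 < x0 $ i $ j" for i j
    using x0 by (simp add: scalings_def pos_matrices_def)
  obtain f g where fg: "\<And>i j. ln (x0 $ i $ j) = - c $ i $ j / \<epsilon> + f i + g j"
    using scalings_ln_eq[OF x0] by (auto simp: pos_matrices_def)
  \<comment> \<open>The potentials paired with the prescribed marginals, plus the difference in mass
    between the all-ones matrix and x0.\<close>
  define \<kappa> where "\<kappa> = \<epsilon> * ((\<Sum>i\<in>UNIV. \<mu>1 $ i * f i) + (\<Sum>j\<in>UNIV. \<mu>2 $ j * g j) +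
    (\<Sum>i\<in>(UNIV::'n1 set). \<Sum>j\<in>(UNIV::'n2 set). 1 - x0 $ i $ j))"
  show ?thesis
  proof (rule that[of \<kappa>])
    fix x assume x: "x \<in> row_constraint \<mu>1 \<inter> col_constraint \<mu>2 \<inter> nonneg_matrices"
    have r: "\<mu>1 $ i = (\<Sum>j\<in>UNIV. x $ i $ j)" for i
      using x by (auto simp: row_constraint_def row_sums_def)
    have s: "\<mu>2 $ j = (\<Sum>i\<in>UNIV. x $ i $ j)" for j
      using x by (auto simp: col_constraint_def col_sums_def)
    have 1: "(\<Sum>i\<in>UNIV. \<mu>1 $ i * f i) = (\<Sum>i\<in>UNIV. \<Sum>j\<in>UNIV. x $ i $ j * f i)"
      by (simp add: r sum_distrib_right)
    have 2: "(\<Sum>j\<in>UNIV. \<mu>2 $ j * g j) = (\<Sum>i\<in>UNIV. \<Sum>j\<in>UNIV. x $ i $ j * g j)"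
      by (subst sum.swap) (simp add: s sum_distrib_right)
    have "c $ i $ j * x $ i $ j + \<epsilon> * kl_term (x $ i $ j) 1 =
      \<epsilon> * kl_term (x $ i $ j) (x0 $ i $ j) +
      \<epsilon> * (x $ i $ j * f i + x $ i $ j * g j + (1 - x0 $ i $ j))" for i j
    \<comment> \<open>The logarithm of the quotient is split only at a positive entry, so zero
      entries are treated apart.\<close>
    proof (cases "x $ i $ j = 0")
      case True
      then show ?thesis by (simp add: kl_term_def algebra_simps)
    next
      case False
      then have "0 < x $ i $ j"
        using x by (simp add: nonneg_matrices_def less_le)
      moreover have "c $ i $ j = \<epsilon> * (f i + g j - ln (x0 $ i $ j))"
        using \<open>0 < \<epsilon>\<close> by (simp add: fg)
      ultimately show ?thesis
        using pos[of i j]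
        by (simp only: kl_term_def ln_divide_pos ln_one zero_less_one) (simp add: algebra_simps)
    qed
    then have "(\<Sum>i\<in>UNIV. \<Sum>j\<in>UNIV. c $ i $ j * x $ i $ j + \<epsilon> * kl_term (x $ i $ j) 1) =
      (\<Sum>i\<in>UNIV. \<Sum>j\<in>UNIV. \<epsilon> * kl_term (x $ i $ j) (x0 $ i $ j) +
      \<epsilon> * (x $ i $ j * f i + x $ i $ j * g j + (1 - x0 $ i $ j)))"
      by simp
    then show "ot_objective c \<epsilon> x = \<epsilon> * KL x x0 + \<kappa>"
      unfolding ot_objective_def KL_eq_sum_kl_term \<kappa>_def 1 2
      by (simp only: vec_lambda_beta sum.distrib sum_distrib_left[symmetric] distrib_left add.assoc)
  qed
qed

text \<open>By the preceding identity and Gibbs' inequality, a feasible scaling strictly beats every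
  other feasible matrix. This yields both the minimality and the uniqueness that \<open>THE\<close>
  asks for.\<close>

lemma ot_minimizer_eqI:
  assumes "x0 \<in> scalings (\<chi> i j. exp (- c $ i $ j / \<epsilon>))" "0 < \<epsilon>"
    and "x0 \<in> row_constraint \<mu>1" "x0 \<in> col_constraint \<mu>2"
  shows "ot_minimizer \<mu>1 \<mu>2 c \<epsilon> = x0"
proof -
  obtain \<kappa> where \<kappa>: "\<And>x. x \<in> row_constraint \<mu>1 \<inter> col_constraint \<mu>2 \<inter> nonneg_matrices \<Longrightarrow>
    ot_objective c \<epsilon> x = \<epsilon> * KL x x0 + \<kappa>"
    using ot_objective_eq_KL[OF assms(1,2)] by blast
  have x0: "x0 \<in> pos_matrices"
    using assms(1) scalings_subset_pos by blast
  then have feas: "x0 \<in> row_constraint \<mu>1 \<inter> col_constraint \<mu>2 \<inter> nonneg_matrices"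
    using assms pos_matrices_subset_nonneg by blast
  have less: "ot_objective c \<epsilon> x0 < ot_objective c \<epsilon> x"
    if "x \<in> row_constraint \<mu>1 \<inter> col_constraint \<mu>2 \<inter> nonneg_matrices" "x \<noteq> x0" for x
    using \<kappa>[OF that(1)] \<kappa>[OF feas] KL_pos[of x x0] that x0 \<open>0 < \<epsilon>\<close> by auto
  show ?thesis
    unfolding ot_minimizer_def
  proof (rule the_equality)
    show "is_arg_min (ot_objective c \<epsilon>)
      (\<lambda>y. y \<in> row_constraint \<mu>1 \<inter> col_constraint \<mu>2 \<inter> nonneg_matrices) x0"
      unfolding is_arg_min_def using feas less by (metis less_asym less_irrefl)
  next
    fix x assume "is_arg_min (ot_objective c \<epsilon>)
      (\<lambda>y. y \<in> row_constraint \<mu>1 \<inter> col_constraint \<mu>2 \<inter> nonneg_matrices) x"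
    then show "x = x0"
      unfolding is_arg_min_def using feas less by blast
  qed
qed

section \<open>Projections onto the marginal constraints and existence of a feasible scaling\<close>

lemma row_sums_nth: "row_sums x $ i = (\<Sum>j\<in>UNIV. x $ i $ j)"
  by (simp add: row_sums_def)

lemma col_sums_nth: "col_sums x $ j = (\<Sum>i\<in>UNIV. x $ i $ j)"
  by (simp add: col_sums_def)

lemma row_sums_pos: "x \<in> pos_matrices \<Longrightarrow> 0 < row_sums x $ i"
  by (simp add: row_sums_def pos_matrices_def sum_pos)

lemma col_sums_eq: "col_sums x = row_sums (transpose x)"
  by (simp add: row_sums_def col_sums_def transpose_def)

lemma col_proj_eq: "col_proj \<mu> x = transpose (row_proj \<mu> (transpose x))"
  by (simp add: row_proj_def col_proj_def col_sums_eq transpose_def mult.commute)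

lemma col_constraint_iff: "x \<in> col_constraint \<mu> \<longleftrightarrow> transpose x \<in> row_constraint \<mu>"
  by (simp add: row_constraint_def col_constraint_def col_sums_eq)

lemma row_proj_in_scalings:
  assumes "x \<in> scalings K" "\<And>i. 0 < \<mu> $ i"
  shows "row_proj \<mu> x \<in> scalings K"
proof -
  have "x \<in> pos_matrices"
    using assms(1) scalings_subset_pos by blast
  then have "(\<chi> i j. x $ i $ j * (\<mu> $ i / row_sums x $ i)) \<in> scalings K"
    using assms by (intro scalings_scale_rows) (simp_all add: row_sums_pos)
  then show ?thesis
    by (simp add: row_proj_def mult.commute)
qed

text \<open>A positive matrix is a scaling of itself, so the preceding lemma applies with K =
  x.\<close>

lemma row_proj_in_pos:
  assumes "x \<in> pos_matrices" "\<And>i. 0 < \<mu> $ i"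
  shows "row_proj \<mu> x \<in> pos_matrices"
  using row_proj_in_scalings[OF self_in_scalings[OF assms(1)] assms(2)] scalings_subset_pos by blast

text \<open>The Pythagorean identity of the Bregman projection, whose defect is the divergence
  between the marginals. Rescaling row i by m / r changes each term by p ln (m / r) + (1 - m / r) x,
  and these changes sum over the row to \<open>kl_term m r\<close>.\<close>

lemma KL_row_proj:
  fixes x :: "real ^ 'n2 ^ 'n1"
  assumes p: "p \<in> pos_matrices" "p \<in> row_constraint \<mu>" and x: "x \<in> pos_matrices"
  shows "KL p x = KL p (row_proj \<mu> x) + (\<Sum>i\<in>UNIV. kl_term (\<mu> $ i) (row_sums x $ i))"
proof -
  have pp: "0 < p $ i $ j" and xp: "0 < x $ i $ j" for i j
    using p x by (auto simp: pos_matrices_def)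
  have \<mu>: "\<mu> $ i = (\<Sum>j\<in>UNIV. p $ i $ j)" for i
    using p by (auto simp: row_constraint_def row_sums_def)
  have mp: "0 < \<mu> $ i" for i
    unfolding \<mu> by (simp add: sum_pos pp)
  have rp: "0 < row_sums x $ i" for i
    using x by (rule row_sums_pos)
  have row: "(\<Sum>j\<in>UNIV. kl_term (p $ i $ j) (x $ i $ j)) =
    (\<Sum>j\<in>UNIV. kl_term (p $ i $ j) (row_proj \<mu> x $ i $ j)) + kl_term (\<mu> $ i) (row_sums x $ i)"
    for i
  proof -
    let ?r = "row_sums x $ i" and ?m = "\<mu> $ i"
    have "kl_term (p $ i $ j) (x $ i $ j) = kl_term (p $ i $ j) (row_proj \<mu> x $ i $ j) +
      (p $ i $ j * ln (?m / ?r) + (1 - ?m / ?r) * x $ i $ j)" for j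
      using pp[of i j] xp[of i j] mp[of i] rp[of i]
      by (simp add: kl_term_def row_proj_def ln_div ln_mult algebra_simps)
    then have "(\<Sum>j\<in>UNIV. kl_term (p $ i $ j) (x $ i $ j)) =
      (\<Sum>j\<in>UNIV. kl_term (p $ i $ j) (row_proj \<mu> x $ i $ j)) +
      ((\<Sum>j\<in>UNIV. p $ i $ j) * ln (?m / ?r) + (1 - ?m / ?r) * (\<Sum>j\<in>UNIV. x $ i $ j))"
      by (simp add: sum.distrib sum_distrib_left sum_distrib_right)
    also have "(\<Sum>j\<in>UNIV. x $ i $ j) = ?r"
      by (simp add: row_sums_def)
    also have "(\<Sum>j\<in>UNIV. p $ i $ j) * ln (?m / ?r) + (1 - ?m / ?r) * ?r = kl_term ?m ?r"
      using rp[of i] unfolding \<mu>[symmetric] by (simp add: kl_term_def field_simps)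
    finally show ?thesis .
  qed
  show ?thesis
    unfolding KL_eq_sum_kl_term row by (simp add: sum.distrib)
qed

lemma KL_row_proj_less:
  assumes p: "p \<in> pos_matrices" "p \<in> row_constraint \<mu>" and x: "x \<in> pos_matrices" "x \<notin> row_constraint \<mu>"
  shows "KL p (row_proj \<mu> x) < KL p x"
proof -
  have "0 < \<mu> $ i" for i
    using row_sums_pos[OF p(1), of i] p(2) by (simp add: row_constraint_def)
  then have nn: "0 \<le> kl_term (\<mu> $ i) (row_sums x $ i)"
    and pos: "\<mu> $ i \<noteq> row_sums x $ i \<Longrightarrow> 0 < kl_term (\<mu> $ i) (row_sums x $ i)" for i
    using x(1) by (simp_all add: kl_term_nonneg kl_term_pos row_sums_pos less_imp_le)
  obtain i where "\<mu> $ i \<noteq> row_sums x $ i"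
    using x(2) unfolding row_constraint_def vec_eq_iff mem_Collect_eq by metis
  then have "0 < (\<Sum>i\<in>UNIV. kl_term (\<mu> $ i) (row_sums x $ i))"
    by (intro sum_pos2[where i = i]) (auto simp: nn pos)
  then show ?thesis
    using KL_row_proj[OF p x(1)] by simp
qed

text \<open>Written in the potentials, minimizing \<open>KL p\<close> over the scalings is the dual
  problem up to sign and constants. The projections stay among the scalings, so their strict
  decrease replaces a first-order condition.\<close>

lemma feasible_scaling_exists:
  fixes K :: "real ^ 'n2 ^ 'n1"
  assumes K: "K \<in> pos_matrices"
    and \<mu>1: "\<And>i. 0 < \<mu>1 $ i" "(\<Sum>i\<in>UNIV. \<mu>1 $ i) = 1"
    and \<mu>2: "\<And>j. 0 < \<mu>2 $ j" "(\<Sum>j\<in>UNIV. \<mu>2 $ j) = 1"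
  obtains x where "x \<in> scalings K" "x \<in> row_constraint \<mu>1" "x \<in> col_constraint \<mu>2"
proof -
  \<comment> \<open>The product coupling is positive and, as both masses are 1, has the two
    prescribed marginals.\<close>
  define p :: "real ^ 'n2 ^ 'n1" where "p = (\<chi> i j. \<mu>1 $ i * \<mu>2 $ j)"
  have p: "p \<in> pos_matrices" "p \<in> row_constraint \<mu>1" "p \<in> col_constraint \<mu>2"
    using \<mu>1 \<mu>2 by (simp_all add: p_def pos_matrices_def row_constraint_def col_constraint_def
      row_sums_def col_sums_def sum_distrib_left[symmetric] sum_distrib_right[symmetric])
  define D where "D = KL_box p (KL p K) \<inter> scalings K"
  have "compact D"
    unfolding D_def using p(1) by (rule compact_KL_box_Int_scalings)
  moreover have KD: "K \<in> D"
    unfolding D_def using KL_le_imp_in_box[OF p(1) K order_refl] self_in_scalings[OF K] by blast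
  moreover have "continuous_on D (KL p)"
    using continuous_on_KL[OF p(1)] by (rule continuous_on_subset)
      (use scalings_subset_pos in \<open>auto simp: D_def\<close>)
  ultimately obtain x where x: "x \<in> D" and min_D: "\<And>y. y \<in> D \<Longrightarrow> KL p x \<le> KL p y"
    using continuous_attains_inf[of D "KL p"] by blast
  \<comment> \<open>A scaling above the level of K is worse than K, which lies in \<open>D\<close>;
    so the minimum over \<open>D\<close> is global.\<close>
  have min: "KL p x \<le> KL p y" if "y \<in> scalings K" for y
  proof (cases "KL p y \<le> KL p K")
    case True
    then have "y \<in> D"
      using that KL_le_imp_in_box[OF p(1)] scalings_subset_pos by (auto simp: D_def)
    then show ?thesis by (rule min_D)
  next
    case False
    then show ?thesis using min_D[OF KD] by simp
  qed
  have xs: "x \<in> scalings K" and xp: "x \<in> pos_matrices"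
    using x scalings_subset_pos by (auto simp: D_def)
  have "x \<in> row_constraint \<mu>1"
    using KL_row_proj_less[OF p(1,2) xp] min[OF row_proj_in_scalings[OF xs \<mu>1(1)]] by fastforce
  \<comment> \<open>The row argument applied to the transposes.\<close>
  moreover have "x \<in> col_constraint \<mu>2"
  proof (rule ccontr)
    assume "x \<notin> col_constraint \<mu>2"
    then have "KL (transpose p) (row_proj \<mu>2 (transpose x)) < KL (transpose p) (transpose x)"
      using p xp by (intro KL_row_proj_less) (simp_all add: col_constraint_iff)
    moreover have "col_proj \<mu>2 x \<in> scalings K"
      using row_proj_in_scalings[of "transpose x" "transpose K" \<mu>2] xs \<mu>2(1)
      by (simp add: transpose_in_scalings_iff[symmetric, of _ K] col_proj_eq)
    moreover have "KL p (col_proj \<mu>2 x) = KL (transpose p) (row_proj \<mu>2 (transpose x))"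
      by (simp add: KL_transpose[symmetric, of p] col_proj_eq)
    ultimately show False
      using min[of "col_proj \<mu>2 x"] by (simp add: KL_transpose)
  qed
  ultimately show ?thesis
    using that xs by blast
qed

section \<open>Relaxed projections\<close>

text \<open>Relaxation multiplies row i by the \<omega>-th power of \<mu>_i divided by the row sum,
  a positive factor.\<close>

lemma relaxed_row_proj_in_scalings:
  assumes x: "x \<in> scalings K" and \<mu>: "\<And>i. 0 < \<mu> $ i"
  shows "relaxed_proj (row_proj \<mu>) \<omega> x \<in> scalings K"
proof -
  have xp: "x \<in> pos_matrices"
    using x scalings_subset_pos by blast
  have "exp ((1 - \<omega>) * ln (x $ i $ j) + \<omega> * ln (row_proj \<mu> x $ i $ j)) =
    x $ i $ j * exp (\<omega> * ln (\<mu> $ i / row_sums x $ i))" for i j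
  proof -
    have pos: "0 < x $ i $ j" "0 < \<mu> $ i / row_sums x $ i"
      using xp \<mu> row_sums_pos[OF xp] by (simp_all add: pos_matrices_def)
    have "ln (row_proj \<mu> x $ i $ j) = ln (\<mu> $ i / row_sums x $ i) + ln (x $ i $ j)"
      using ln_mult_pos[OF pos(2,1)] by (simp add: row_proj_def)
    then have "(1 - \<omega>) * ln (x $ i $ j) + \<omega> * ln (row_proj \<mu> x $ i $ j) =
      ln (x $ i $ j) + \<omega> * ln (\<mu> $ i / row_sums x $ i)"
      by (simp only:) (simp add: algebra_simps)
    then show ?thesis
      using pos(1) by (simp only: exp_add exp_ln)
  qed
  then have "relaxed_proj (row_proj \<mu>) \<omega> x =
    (\<chi> i j. x $ i $ j * exp (\<omega> * ln (\<mu> $ i / row_sums x $ i)))"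
    by (simp add: relaxed_proj_def)
  then show ?thesis
    using scalings_scale_rows[OF x] by simp
qed

lemma relaxed_col_proj_eq:
  "relaxed_proj (col_proj \<mu>) \<omega> x = transpose (relaxed_proj (row_proj \<mu>) \<omega> (transpose x))"
  by (simp add: relaxed_proj_def col_proj_eq) (simp add: transpose_def)

lemma relaxed_col_proj_in_scalings:
  assumes x: "x \<in> scalings K" and \<mu>: "\<And>j. 0 < \<mu> $ j"
  shows "relaxed_proj (col_proj \<mu>) \<omega> x \<in> scalings K"
  using relaxed_row_proj_in_scalings[of "transpose x" "transpose K" \<mu> \<omega>] assms
  by (simp add: transpose_in_scalings_iff[symmetric, of _ K] relaxed_col_proj_eq)

lemma relaxed_proj_in_pos: "relaxed_proj P \<omega> x \<in> pos_matrices"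
  by (simp add: relaxed_proj_def pos_matrices_def)

lemma relaxed_proj_fixed:
  assumes "x \<in> pos_matrices" "P x = x"
  shows "relaxed_proj P \<omega> x = x"
proof -
  have "(1 - \<omega>) * ln (x $ i $ j) + \<omega> * ln (P x $ i $ j) = ln (x $ i $ j)" for i j
    using assms(2) by (simp add: algebra_simps)
  then show ?thesis
    using assms(1) by (simp add: relaxed_proj_def pos_matrices_def vec_eq_iff)
qed

lemma row_proj_fixed:
  assumes "x \<in> pos_matrices" "x \<in> row_constraint \<mu>"
  shows "row_proj \<mu> x = x"
  using assms row_sums_pos[OF assms(1)]
  by (auto simp: row_proj_def row_constraint_def vec_eq_iff less_imp_neq[symmetric])

text \<open>Both logarithms have positive arguments, and the exponent varies continuously because
  \<Theta> does.\<close>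

lemma continuous_on_relaxed_proj:
  assumes "continuous_on pos_matrices P" "P ` pos_matrices \<subseteq> pos_matrices"
    and "continuous_on pos_matrices \<Theta>"
  shows "continuous_on pos_matrices (\<lambda>x. relaxed_proj P (\<Theta> x) x)"
proof -
  have "0 < P x $ i $ j" if "x \<in> pos_matrices" for x i j
    using assms(2) that by (auto simp: pos_matrices_def)
  then show ?thesis
    unfolding relaxed_proj_def using assms(1,3)
    by (intro continuous_intros continuous_on_vec_lambda)
      (auto simp: pos_matrices_def less_imp_neq[symmetric])
qed

lemma continuous_on_row_proj: "continuous_on pos_matrices (row_proj \<mu>)"
proof -
  have "continuous_on pos_matrices (\<lambda>x. row_proj \<mu> x)"
    unfolding row_proj_def row_sums_nth
    by (intro continuous_intros continuous_on_vec_lambda)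
      (simp add: row_sums_nth[symmetric] less_imp_neq[OF row_sums_pos, symmetric])
  then show ?thesis by simp
qed

lemma col_sums_pos: "x \<in> pos_matrices \<Longrightarrow> 0 < col_sums x $ j"
  by (simp add: col_sums_eq row_sums_pos)

lemma continuous_on_col_proj: "continuous_on pos_matrices (col_proj \<mu>)"
proof -
  have "continuous_on pos_matrices (\<lambda>x. col_proj \<mu> x)"
    unfolding col_proj_def col_sums_nth
    by (intro continuous_intros continuous_on_vec_lambda)
      (simp add: col_sums_nth[symmetric] less_imp_neq[OF col_sums_pos, symmetric])
  then show ?thesis by simp
qed

section \<open>Convergence\<close>

text \<open>A LaSalle-type principle: by compactness a nonconvergent orbit has a cluster point other
  than a, but monotonicity of F along the orbit prevents a step of T from decreasing F at a cluster
  point.\<close>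

lemma Lyapunov_convergence:
  fixes x :: "nat \<Rightarrow> 'a::metric_space" and F :: "'a \<Rightarrow> real"
  assumes D: "compact D" "\<And>n. x n \<in> D"
    and step: "\<And>n. x (Suc n) = T (x n)"
    and cont: "continuous_on D F" "continuous_on D (\<lambda>y. F (T y))"
    and decr: "\<And>n. F (x (Suc n)) \<le> F (x n)"
    and fixed: "\<And>y. y \<in> D \<Longrightarrow> F y \<le> F (T y) \<Longrightarrow> y = a"
  shows "x \<longlonglongrightarrow> a"
proof (rule ccontr)
  assume "\<not> x \<longlonglongrightarrow> a"
  then obtain e where e: "0 < e" "\<not> (\<forall>\<^sub>F n in sequentially. dist (x n) a < e)"
    by (auto simp: tendsto_iff)
  \<comment> \<open>Failure of eventual closeness gives infinitely many distant indices, hence a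
    subsequence at distance at least e from a.\<close>
  then have "infinite {n. e \<le> dist (x n) a}"
    by (simp add: not_less[symmetric] eventually_cofinite[symmetric] cofinite_eq_sequentially)
  then obtain r :: "nat \<Rightarrow> nat" where r: "strict_mono r" "\<And>n. e \<le> dist (x (r n)) a"
    by (auto dest: infinite_enumerate)
  have "\<forall>n. (x \<circ> r) n \<in> D"
    using D(2) by simp
  then obtain y s where y: "y \<in> D" "strict_mono s" "((x \<circ> r) \<circ> s) \<longlonglongrightarrow> y"
    using D(1) unfolding compact_def by meson
  define t where "t = r \<circ> s"
  have t: "strict_mono t" "(\<lambda>n. x (t n)) \<longlonglongrightarrow> y"
    using y r(1) by (auto simp: t_def strict_mono_def o_def)
  have lim: "(\<lambda>n. F (x (t n))) \<longlonglongrightarrow> F y"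
    by (rule continuous_on_tendsto_compose[OF cont(1) t(2) y(1)]) (simp add: D)
  have limT: "(\<lambda>n. F (x (Suc (t n)))) \<longlonglongrightarrow> F (T y)"
    unfolding step by (rule continuous_on_tendsto_compose[OF cont(2) t(2) y(1)]) (simp add: D)
  have anti: "decseq (\<lambda>n. F (x n))"
    using decr by (rule decseq_SucI)
  \<comment> \<open>Since Suc (t n) \<le> t (Suc n), the next subsequence value lies below the value
    one step after the current one; in the limit this compares y with T y.\<close>
  have "F (x (t (Suc n))) \<le> F (x (Suc (t n)))" for n
    using strict_monoD[OF t(1), of n "Suc n"] decseqD[OF anti] by (simp add: Suc_le_eq)
  then have "F y \<le> F (T y)"
    using LIMSEQ_le[OF LIMSEQ_Suc[OF lim] limT] by blast
  then have "y = a"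
    using fixed y(1) by blast
  moreover have "e \<le> dist y a"
    by (rule Lim_bounded2[OF tendsto_dist[OF t(2) tendsto_const], of 0]) (simp add: t_def r(2))
  ultimately show False
    using e(1) by simp
qed

theorem theorem1:
  fixes \<mu>1 :: "real ^ 'n1"
    and \<mu>2 :: "real ^ 'n2"
    and c :: "real ^ 'n2 ^ 'n1"
    and \<epsilon> :: real
    and \<Theta>1 \<Theta>2 :: "real ^ 'n2 ^ 'n1 \<Rightarrow> real"
    and \<gamma> \<gamma>' :: "nat \<Rightarrow> real ^ 'n2 ^ 'n1"
  assumes "\<And>i. 0 < \<mu>1 $ i" and "(\<Sum>i\<in>UNIV. \<mu>1 $ i) = 1"
    and "\<And>j. 0 < \<mu>2 $ j" and "(\<Sum>j\<in>UNIV. \<mu>2 $ j) = 1"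
    and "\<And>i j. 0 \<le> c $ i $ j"
    and "0 < \<epsilon>"
    and "continuous_on pos_matrices \<Theta>1" and "\<And>x. x \<in> pos_matrices \<Longrightarrow> 0 \<le> \<Theta>1 x"
    and "continuous_on pos_matrices \<Theta>2" and "\<And>x. x \<in> pos_matrices \<Longrightarrow> 0 \<le> \<Theta>2 x"
    and "\<And>x. x \<in> pos_matrices \<Longrightarrow>
           lyapunov \<mu>1 \<mu>2 c \<epsilon> (relaxed_proj (row_proj \<mu>1) (\<Theta>1 x) x) \<le> lyapunov \<mu>1 \<mu>2 c \<epsilon> x"
    and "\<And>x. x \<in> pos_matrices \<Longrightarrow> x \<notin> row_constraint \<mu>1 \<Longrightarrow>
           lyapunov \<mu>1 \<mu>2 c \<epsilon> (relaxed_proj (row_proj \<mu>1) (\<Theta>1 x) x) < lyapunov \<mu>1 \<mu>2 c \<epsilon> x"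
    and "\<And>x. x \<in> pos_matrices \<Longrightarrow>
           lyapunov \<mu>1 \<mu>2 c \<epsilon> (relaxed_proj (col_proj \<mu>2) (\<Theta>2 x) x) \<le> lyapunov \<mu>1 \<mu>2 c \<epsilon> x"
    and "\<And>x. x \<in> pos_matrices \<Longrightarrow> x \<notin> col_constraint \<mu>2 \<Longrightarrow>
           lyapunov \<mu>1 \<mu>2 c \<epsilon> (relaxed_proj (col_proj \<mu>2) (\<Theta>2 x) x) < lyapunov \<mu>1 \<mu>2 c \<epsilon> x"
    and "\<gamma> 0 = (\<chi> i j. exp (- c $ i $ j / \<epsilon>))"
    and "\<And>l. \<gamma>' (Suc l) = relaxed_proj (row_proj \<mu>1) (\<Theta>1 (\<gamma> l)) (\<gamma> l)"
    and "\<And>l. \<gamma> (Suc l) = relaxed_proj (col_proj \<mu>2) (\<Theta>2 (\<gamma>' (Suc l))) (\<gamma>' (Suc l))"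
  shows "\<gamma> \<longlonglongrightarrow> ot_minimizer \<mu>1 \<mu>2 c \<epsilon>"
proof -
  define K :: "real ^ 'n2 ^ 'n1" where "K = (\<chi> i j. exp (- c $ i $ j / \<epsilon>))"
  define p where "p = ot_minimizer \<mu>1 \<mu>2 c \<epsilon>"
  define T1 where "T1 x = relaxed_proj (row_proj \<mu>1) (\<Theta>1 x) x" for x
  define T2 where "T2 x = relaxed_proj (col_proj \<mu>2) (\<Theta>2 x) x" for x
  have K: "K \<in> pos_matrices"
    by (simp add: K_def pos_matrices_def)
  have optimal: "x = p" if "x \<in> scalings K" "x \<in> row_constraint \<mu>1" "x \<in> col_constraint \<mu>2" for x
    using ot_minimizer_eqI[OF _ \<open>0 < \<epsilon>\<close> that(2,3)] that(1) by (simp add: K_def p_def)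
  obtain x0 where "x0 \<in> scalings K" "x0 \<in> row_constraint \<mu>1" "x0 \<in> col_constraint \<mu>2"
    using feasible_scaling_exists[OF K assms(1-4)] by blast
  \<comment> \<open>The optimal plan coincides with the feasible scaling and inherits its
    positivity, on which the continuity and compactness arguments for \<open>KL p\<close>
    rest.\<close>
  then have p: "p \<in> pos_matrices"
    using optimal scalings_subset_pos by blast
  have le1: "KL p (T1 x) \<le> KL p x" and le2: "KL p (T2 x) \<le> KL p x" if "x \<in> pos_matrices" for x
    using assms(11,13)[OF that] by (simp_all add: lyapunov_def p_def T1_def T2_def)
  have less1: "x \<notin> row_constraint \<mu>1 \<Longrightarrow> KL p (T1 x) < KL p x"
    and less2: "x \<notin> col_constraint \<mu>2 \<Longrightarrow> KL p (T2 x) < KL p x" if "x \<in> pos_matrices" for x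
    using assms(12,14)[OF that] by (simp_all add: lyapunov_def p_def T1_def T2_def)
  have T1_pos: "T1 x \<in> pos_matrices" and T2_pos: "T2 x \<in> pos_matrices" for x
    by (simp_all add: T1_def T2_def relaxed_proj_in_pos)
  \<comment> \<open>Eliminating the half iterates, which enter only from index 1 on, turns the
    sequence into an orbit of a single map.\<close>
  have step: "\<gamma> (Suc n) = T2 (T1 (\<gamma> n))" for n
    using assms(16,17) by (simp add: T1_def T2_def)
  have scal: "\<gamma> n \<in> scalings K" for n
  proof (induction n)
    case 0
    then show ?case using self_in_scalings[OF K] assms(15) by (simp add: K_def)
  next
    case (Suc n)
    then show ?case
      using assms(1,3) unfolding step T1_def T2_def
      by (intro relaxed_col_proj_in_scalings relaxed_row_proj_in_scalings)
  qed
  then have pos: "\<gamma> n \<in> pos_matrices" for n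
    using scalings_subset_pos by blast
  have decr: "KL p (\<gamma> (Suc n)) \<le> KL p (\<gamma> n)" for n
    unfolding step using le2[OF T1_pos] le1[OF pos] by (rule order_trans)
  have bound: "KL p (\<gamma> n) \<le> KL p (\<gamma> 0)" for n
    using decseqD[OF decseq_SucI, of "\<lambda>n. KL p (\<gamma> n)", OF decr, of 0 n] by simp
  \<comment> \<open>The level is the initial value of the Lyapunov function, so the whole orbit
    stays in this compact set.\<close>
  define D where "D = KL_box p (KL p (\<gamma> 0)) \<inter> scalings K"
  have D_pos: "D \<subseteq> pos_matrices"
    using scalings_subset_pos by (auto simp: D_def)
  have rp: "row_proj \<mu>1 ` pos_matrices \<subseteq> (pos_matrices :: (real ^ 'n2 ^ 'n1) set)"
    using row_proj_in_pos assms(1) by blast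
  have cp: "col_proj \<mu>2 ` pos_matrices \<subseteq> (pos_matrices :: (real ^ 'n2 ^ 'n1) set)"
    using assms(3) by (simp add: image_subset_iff col_proj_eq row_proj_in_pos)
  have cT1: "continuous_on pos_matrices T1"
    using continuous_on_relaxed_proj[OF continuous_on_row_proj rp assms(7)]
    by (simp add: T1_def[abs_def])
  have cT2: "continuous_on pos_matrices T2"
    using continuous_on_relaxed_proj[OF continuous_on_col_proj cp assms(9)]
    by (simp add: T2_def[abs_def])
  have cF: "continuous_on pos_matrices (KL p)"
    using p by (rule continuous_on_KL)
  have "continuous_on pos_matrices (\<lambda>x. T2 (T1 x))"
    by (rule continuous_on_compose2[OF cT2 cT1]) (use T1_pos in blast)
  then have cFT: "continuous_on pos_matrices (\<lambda>x. KL p (T2 (T1 x)))"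
    by (rule continuous_on_compose2[OF cF]) (use T2_pos in blast)
  have "\<gamma> \<longlonglongrightarrow> p"
  proof (rule Lyapunov_convergence[where D = D and F = "KL p" and T = "\<lambda>x. T2 (T1 x)"])
    show "compact D"
      unfolding D_def using p by (rule compact_KL_box_Int_scalings)
    show "\<gamma> n \<in> D" for n
      using KL_le_imp_in_box[OF p pos bound] scal by (simp add: D_def)
    show "continuous_on D (KL p)" "continuous_on D (\<lambda>x. KL p (T2 (T1 x)))"
      using cF cFT D_pos by (blast intro: continuous_on_subset)+
    show "y = p" if y: "y \<in> D" "KL p y \<le> KL p (T2 (T1 y))" for y
    proof (rule optimal)
      have yp: "y \<in> pos_matrices"
        using y(1) D_pos by blast
      show "y \<in> scalings K"
        using y(1) by (simp add: D_def)
      \<comment> \<open>If the row constraint failed, the first half step would decrease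
        \<open>KL p\<close> strictly, and the second cannot raise it again.\<close>
      show row: "y \<in> row_constraint \<mu>1"
        using less1[OF yp] le2[OF T1_pos, of y] y(2) by fastforce
      \<comment> \<open>With correct row sums the first half step does nothing, whatever \<Theta>1
        is, so the second one is tested at y itself.\<close>
      have "T1 y = y"
        unfolding T1_def using yp row by (intro relaxed_proj_fixed row_proj_fixed)
      then show "y \<in> col_constraint \<mu>2"
        using less2[OF yp] y(2) by fastforce
    qed
  qed (rule step decr)+
  then show ?thesis
    by (simp add: p_def)
qed

end
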